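(* Let $N=2$, let $\omega>0$ be fixed, and let $\lambda,\mu\in\mathbb R$ be fixed Lamé constants with $\mu>0$ and $\lambda+\mu>0$. Then for any $0<r_0<r_1$ there exist constant densities $\rho_0,\rho_1>0$ for which the homogeneous transmission problem $$\begin{cases}\nabla\cdot(\mathcal C^{(0)}:\nabla u_1)+\omega^2\rho_1u_1=0 & \text{in } r_0<|x|<r_1,\\ \nabla\cdot(\mathcal C^{(0)}:\nabla u_0)+\omega^2\rho_0u_0=0 & \text{in } |x|<r_0,\\ Tu_1=0 & \text{on } |x|=r_1,\\ u_1=u_0,\quad Tu_1=Tu_0 & \text{on } |x|=r_0,\end{cases}$$ with $x\in\mathbb R^2$ and vector fields $u_0,u_1$ valued in $\mathbb C^2$, admits a non-trivial solution $(u_0,u_1)\neq(0,0)$.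
   Context: $C^{(0)}_{ijkl}=\lambda\delta_{ij}\delta_{kl}+\mu(\delta_{ik}\delta_{jl}+\delta_{il}\delta_{jk})$, $(\mathcal C^{(0)}:\nabla u)_{ij}=\sum_{k,l}C^{(0)}_{ijkl}\,\partial_l u_k$, so that $\nabla\cdot(\mathcal C^{(0)}:\nabla u)=\mu\Delta u+(\lambda+\mu)\nabla(\nabla\cdot u)$. $Tu=\nu\cdot(\mathcal C^{(0)}:\nabla u)=2\mu\,\partial_\nu u+\lambda\nu\,(\nabla\cdot u)+\mu\tau(\partial_2u_1-\partial_1u_2)$ with $\nu=(\nu_1,\nu_2)=x/|x|$ and $\tau=(-\nu_2,\nu_1)$ (in this formula $u=(u_1,u_2)$ denotes the components of $u$). *)

theory Defs
  imports "HOL-Analysis.Analysis"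
begin

definition partial_deriv :: "2 \<Rightarrow> (real^2 \<Rightarrow> complex) \<Rightarrow> real^2 \<Rightarrow> complex" where
  "partial_deriv l f x = frechet_derivative f (at x) (axis l 1)"

definition C1_on :: "(real^2) set \<Rightarrow> (real^2 \<Rightarrow> complex) \<Rightarrow> bool" where
  "C1_on D f \<longleftrightarrow> (\<forall>x\<in>D. f differentiable (at x)) \<and> (\<forall>l. continuous_on D (partial_deriv l f))"

definition C2_on :: "(real^2) set \<Rightarrow> (real^2 \<Rightarrow> complex) \<Rightarrow> bool" where
  "C2_on D f \<longleftrightarrow> C1_on D f \<and> (\<forall>l. C1_on D (partial_deriv l f))"

text \<open>For open \<open>D\<close>: \<open>f\<close> and its first partial derivatives on \<open>D\<close> extend continuously to
  the closure, the extension of \<open>f\<close> being given by its own values on the boundary.\<close>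

definition C1_upto_boundary :: "(real^2) set \<Rightarrow> (real^2 \<Rightarrow> complex) \<Rightarrow> bool" where
  "C1_upto_boundary D f \<longleftrightarrow> C1_on D f \<and> continuous_on (closure D) f \<and>
     (\<forall>l. \<exists>g. continuous_on (closure D) g \<and> (\<forall>x\<in>D. g x = partial_deriv l f x))"

definition classically_regular :: "(real^2) set \<Rightarrow> (real^2 \<Rightarrow> complex^2) \<Rightarrow> bool" where
  "classically_regular D u \<longleftrightarrow>
     (\<forall>k. C2_on D (\<lambda>x. u x $ k) \<and> C1_upto_boundary D (\<lambda>x. u x $ k))"

definition kronecker :: "2 \<Rightarrow> 2 \<Rightarrow> real" where
  "kronecker i j = (if i = j then 1 else 0)"

definition elastic_tensor :: "real \<Rightarrow> real \<Rightarrow> 2 \<Rightarrow> 2 \<Rightarrow> 2 \<Rightarrow> 2 \<Rightarrow> real" where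
  "elastic_tensor lam mu i j k l =
     lam * kronecker i j * kronecker k l
     + mu * (kronecker i k * kronecker j l + kronecker i l * kronecker j k)"

definition stress :: "real \<Rightarrow> real \<Rightarrow> (real^2 \<Rightarrow> complex^2) \<Rightarrow> real^2 \<Rightarrow> complex^2^2" where
  "stress lam mu u x =
     (\<chi> i j. \<Sum>k\<in>UNIV. \<Sum>l\<in>UNIV.
        complex_of_real (elastic_tensor lam mu i j k l) * partial_deriv l (\<lambda>y. u y $ k) x)"

definition div_stress :: "real \<Rightarrow> real \<Rightarrow> (real^2 \<Rightarrow> complex^2) \<Rightarrow> real^2 \<Rightarrow> complex^2" where
  "div_stress lam mu u x =
     (\<chi> i. \<Sum>j\<in>UNIV. partial_deriv j (\<lambda>y. stress lam mu u y $ i $ j) x)"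

definition radial_normal :: "real^2 \<Rightarrow> real^2" where
  "radial_normal x = x /\<^sub>R norm x"

text \<open>Since the normal is the radial field \<open>x / |x|\<close>, the traction is defined at every point
  \<open>x \<noteq> 0\<close>; its values on a boundary circle are the limits from inside the domain.\<close>

definition traction :: "real \<Rightarrow> real \<Rightarrow> (real^2 \<Rightarrow> complex^2) \<Rightarrow> real^2 \<Rightarrow> complex^2" where
  "traction lam mu u x =
     (\<chi> i. \<Sum>j\<in>UNIV. complex_of_real (radial_normal x $ j) * stress lam mu u x $ i $ j)"

definition has_boundary_traction ::
  "real \<Rightarrow> real \<Rightarrow> (real^2) set \<Rightarrow> (real^2 \<Rightarrow> complex^2) \<Rightarrow> real^2 \<Rightarrow> complex^2 \<Rightarrow> bool" where
  "has_boundary_traction lam mu D u z t \<longleftrightarrow> (traction lam mu u \<longlongrightarrow> t) (at z within D)"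

definition disk :: "real \<Rightarrow> (real^2) set" where
  "disk r0 = {x. norm x < r0}"

definition annulus :: "real \<Rightarrow> real \<Rightarrow> (real^2) set" where
  "annulus r0 r1 = {x. r0 < norm x \<and> norm x < r1}"

definition transmission_solution ::
  "real \<Rightarrow> real \<Rightarrow> real \<Rightarrow> real \<Rightarrow> real \<Rightarrow> real \<Rightarrow> real
    \<Rightarrow> (real^2 \<Rightarrow> complex^2) \<Rightarrow> (real^2 \<Rightarrow> complex^2) \<Rightarrow> bool" where
  "transmission_solution lam mu omega r0 r1 rho0 rho1 u0 u1 \<longleftrightarrow>
     classically_regular (disk r0) u0 \<and>
     classically_regular (annulus r0 r1) u1 \<and>
     (\<forall>x\<in>annulus r0 r1. div_stress lam mu u1 x + (omega\<^sup>2 * rho1) *\<^sub>R u1 x = 0) \<and>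
     (\<forall>x\<in>disk r0. div_stress lam mu u0 x + (omega\<^sup>2 * rho0) *\<^sub>R u0 x = 0) \<and>
     (\<forall>z. norm z = r1 \<longrightarrow> has_boundary_traction lam mu (annulus r0 r1) u1 z 0) \<and>
     (\<forall>z. norm z = r0 \<longrightarrow> u1 z = u0 z \<and>
        (\<exists>t. has_boundary_traction lam mu (annulus r0 r1) u1 z t \<and>
             has_boundary_traction lam mu (disk r0) u0 z t))"

text \<open>Explicit form of the traction, with tangent \<open>\<tau> = (-\<nu>\<^sub>2, \<nu>\<^sub>1)\<close>:
  \<open>2\<mu> \<partial>\<^sub>\<nu> u + \<lambda> \<nu> (\<nabla>\<cdot>u) + \<mu> \<tau> (\<partial>\<^sub>2 u\<^sub>1 - \<partial>\<^sub>1 u\<^sub>2)\<close>.\<close>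

lemma traction_explicit:
  fixes u :: "real^2 \<Rightarrow> complex^2" and x :: "real^2" and lam mu :: real
    and d :: "2 \<Rightarrow> 2 \<Rightarrow> complex" and n :: "2 \<Rightarrow> complex"
  defines "d \<equiv> \<lambda>l k. partial_deriv l (\<lambda>y. u y $ k) x"
    and "n \<equiv> \<lambda>j. complex_of_real (radial_normal x $ j)"
  shows "traction lam mu u x $ 1 =
           2 * mu * (n 1 * d 1 1 + n 2 * d 2 1) + lam * n 1 * (d 1 1 + d 2 2)
           - mu * n 2 * (d 2 1 - d 1 2)"
    and "traction lam mu u x $ 2 =
           2 * mu * (n 1 * d 1 2 + n 2 * d 2 2) + lam * n 2 * (d 1 1 + d 2 2)
           + mu * n 1 * (d 2 1 - d 1 2)"
  by (simp_all add: traction_def stress_def elastic_tensor_def kronecker_def sum_2 d_def n_def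
      algebra_simps)

end

theory Submission
  imports Defs
begin

text \<open>The densities may be taken equal, which reduces the problem to a Neumann eigenfunction of
  the disk of radius \<open>r1\<close>. The torsional field \<open>u(x) = h(a |x|\<^sup>2) (-x\<^sub>2, x\<^sub>1)\<close> is divergence
  free, it solves the Lame equation with \<open>\<omega>\<^sup>2 \<rho> = 4 a \<mu>\<close> as soon as \<open>s h'' + 2 h' + h = 0\<close>, and all
  entries of its stress are multiples of \<open>h'(a |x|\<^sup>2)\<close>. The solution \<open>h\<close> that is regular at \<open>0\<close> is
  \<open>J\<^sub>1(t) / t\<close> (up to a factor) in the variable \<open>s = t\<^sup>2 / 4\<close>, and \<open>-h'\<close> is likewise
  \<open>J\<^sub>2(t) / t\<^sup>2\<close>. This has a positive zero \<open>s\<^sub>0\<close>, and \<open>a = s\<^sub>0 / r1\<^sup>2\<close> makes the traction vanish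
  on the outer circle.\<close>

subsection \<open>Bessel--Clifford functions\<close>

definition bessel_coeff :: "nat \<Rightarrow> nat \<Rightarrow> real" where
  "bessel_coeff p n = (-1) ^ n / (fact n * fact (n + p))"

text \<open>\<open>J\<^sub>p(t) = (t/2)\<^sup>p * bessel_clifford p (t\<^sup>2/4)\<close>\<close>

definition bessel_clifford :: "nat \<Rightarrow> real \<Rightarrow> real" where
  "bessel_clifford p s = (\<Sum>n. bessel_coeff p n * s ^ n)"

lemma summable_bessel_coeff: "summable (\<lambda>n. bessel_coeff p n * s ^ n)"
proof (rule summable_comparison_test')
  show "summable (\<lambda>n. inverse (fact n) * \<bar>s\<bar> ^ n)"
    by (rule summable_exp)
  fix n :: nat
  have "1 / (fact n * fact (n + p)) \<le> 1 / (fact n :: real)"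
    by (intro divide_left_mono) (auto simp: mult_le_cancel_left1)
  then have "1 / (fact n * fact (n + p)) * \<bar>s\<bar> ^ n \<le> 1 / (fact n :: real) * \<bar>s\<bar> ^ n"
    by (intro mult_right_mono) auto
  then show "norm (bessel_coeff p n * s ^ n) \<le> inverse (fact n) * \<bar>s\<bar> ^ n"
    by (simp add: bessel_coeff_def abs_mult power_abs inverse_eq_divide)
qed

text \<open>Termwise differentiation: the factor \<open>n + 1\<close> cancels against
  \<open>fact (n + 1)\<close>, while the other factorial becomes
  \<open>fact (n + Suc p)\<close>.\<close>

lemma DERIV_bessel_clifford:
  "(bessel_clifford p has_field_derivative - bessel_clifford (Suc p) s) (at s)"
proof -
  have "diffs (bessel_coeff p) n * s ^ n = - (bessel_coeff (Suc p) n * s ^ n)" for n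
    by (simp add: diffs_def bessel_coeff_def divide_simps)
  then have "(\<Sum>n. diffs (bessel_coeff p) n * s ^ n) = - bessel_clifford (Suc p) s"
    unfolding bessel_clifford_def using suminf_minus[OF summable_bessel_coeff] by simp
  then show ?thesis
    using termdiffs_strong_converges_everywhere[OF summable_bessel_coeff[of p], of s]
    by (simp add: bessel_clifford_def[abs_def])
qed

lemma isCont_bessel_clifford: "isCont (bessel_clifford p) s"
  by (rule DERIV_isCont[OF DERIV_bessel_clifford])

lemma continuous_on_bessel_clifford [continuous_intros]:
  "continuous_on S f \<Longrightarrow> continuous_on S (\<lambda>x. bessel_clifford p (f x))"
  by (rule continuous_on_compose2[of UNIV])
     (auto intro: continuous_at_imp_continuous_on isCont_bessel_clifford)

text \<open>As each derivative raises the index and flips the sign, this is the equation s h'' + (p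
  + 1) h' + h = 0 for h = \<open>bessel_clifford p\<close>. It follows by comparing coefficients;
  the constant terms cancel, which allows the index shift.\<close>

lemma bessel_clifford_recurrence:
  "bessel_clifford p s
     = real (Suc p) * bessel_clifford (Suc p) s - s * bessel_clifford (Suc (Suc p)) s"
proof -
  let ?t = "\<lambda>n. bessel_coeff p n * s ^ n - real (Suc p) * (bessel_coeff (Suc p) n * s ^ n)"
  have sm: "summable ?t"
    by (intro summable_diff summable_mult summable_bessel_coeff)
  have "?t (Suc n) = - s * (bessel_coeff (Suc (Suc p)) n * s ^ n)" for n
  proof -
    have "bessel_coeff p (Suc n) - real (Suc p) * bessel_coeff (Suc p) (Suc n)
      = - bessel_coeff (Suc (Suc p)) n"
      by (simp add: bessel_coeff_def divide_simps) (simp add: algebra_simps)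
    from arg_cong[OF this, of "\<lambda>c. c * s ^ Suc n"] show ?thesis
      by (simp add: algebra_simps)
  qed
  then have "(\<Sum>n. ?t (Suc n)) = - s * bessel_clifford (Suc (Suc p)) s"
    unfolding bessel_clifford_def by (simp only: suminf_mult[OF summable_bessel_coeff])
  moreover have "?t 0 = 0"
    by (simp add: bessel_coeff_def divide_simps)
  moreover have "suminf ?t = ?t 0 + (\<Sum>n. ?t (Suc n))"
    using suminf_split_head[OF sm] by simp
  moreover have "suminf ?t = bessel_clifford p s - real (Suc p) * bessel_clifford (Suc p) s"
    unfolding bessel_clifford_def
    by (subst suminf_diff[symmetric])
       (auto intro: summable_mult summable_bessel_coeff simp: suminf_mult summable_bessel_coeff)
  ultimately show ?thesis by simp
qed

section \<open>A positive zero of the second Bessel-Clifford function\<close>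

lemma bessel_clifford_0: "bessel_clifford p 0 = 1 / fact p"
  unfolding bessel_clifford_def powser_zero by (simp add: bessel_coeff_def)

text \<open>The first zero lies near 6.59, so 8 is just beyond it. Seven terms sum to about -0.019,
  and a geometric bound keeps the tail below 0.004.\<close>

lemma bessel_clifford_2_neg: "bessel_clifford 2 8 < 0"
proof -
  let ?t = "\<lambda>n. bessel_coeff 2 n * 8 ^ n"
  have tail: "norm (?t (n + 7)) \<le> (1/500) * (1/2) ^ n" for n
  proof (induction n)
    case 0
    show ?case by (simp add: bessel_coeff_def fact_numeral)
  next
    case (Suc n)
    have step: "norm (?t (Suc m)) = norm (?t m) * (8 / (real (Suc m) * real (m + 3)))" for m
      by (simp add: bessel_coeff_def abs_mult divide_simps)
    \<comment> \<open>From index 7 on, consecutive terms shrink by at least a factor 10; the ratio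
      1/2 is enough.\<close>
    have "8 * 10 \<le> real (Suc (n + 7)) * real (n + 7 + 3)" by (intro mult_mono) auto
    then have "8 / (real (Suc (n + 7)) * real (n + 7 + 3)) \<le> 1/2"
      by (subst divide_le_eq) auto
    then have "norm (?t (Suc (n + 7))) \<le> ((1/500) * (1/2) ^ n) * (1/2)"
      unfolding step by (intro mult_mono Suc.IH) auto
    then show ?case by simp
  qed
  have geo: "(\<lambda>n. (1/500) * (1/2::real) ^ n) sums ((1/500) * (1 / (1 - 1/2)))"
    by (intro sums_mult geometric_sums) simp
  have "norm (\<Sum>n. ?t (n + 7)) \<le> (\<Sum>n. (1/500) * (1/2::real) ^ n)"
    by (rule norm_suminf_le[OF tail sums_summable[OF geo]])
  also have "\<dots> = 1 / 250" using sums_unique[OF geo] by simp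
  finally have "(\<Sum>n. ?t (n + 7)) \<le> 1 / 250" by simp
  moreover have "bessel_clifford 2 8 = (\<Sum>n. ?t (n + 7)) + (\<Sum>n<7. ?t n)"
    unfolding bessel_clifford_def
    by (rule suminf_split_initial_segment[OF summable_bessel_coeff])
  moreover have "(\<Sum>n<7. ?t n) < - (1/100)"
    by (simp add: eval_nat_numeral bessel_coeff_def)
  ultimately show ?thesis by linarith
qed

lemma bessel_clifford_2_zero: obtains s where "s > 0" "bessel_clifford 2 s = 0"
proof -
  have "\<exists>s\<ge>0. s \<le> 8 \<and> bessel_clifford 2 s = 0"
    by (rule IVT2) (use bessel_clifford_2_neg in \<open>auto simp: bessel_clifford_0 isCont_bessel_clifford\<close>)
  then obtain s where "s \<ge> 0" "bessel_clifford 2 s = 0" by auto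
  moreover from this have "s \<noteq> 0" by (auto simp: bessel_clifford_0)
  ultimately show thesis using that[of s] by simp
qed

subsection \<open>Partial derivatives of real scalar fields\<close>

lemma GDERIV_imp_has_derivative_of_real:
  assumes "GDERIV f x :> g"
  shows "((\<lambda>y. complex_of_real (f y)) has_derivative (\<lambda>h. complex_of_real (h \<bullet> g))) (at x)"
  using assms unfolding gderiv_def by (rule has_derivative_of_real)

lemma partial_deriv_of_real:
  assumes "GDERIV f x :> g"
  shows "partial_deriv l (\<lambda>y. complex_of_real (f y)) x = complex_of_real (g $ l)"
  unfolding partial_deriv_def
    frechet_derivative_at[OF GDERIV_imp_has_derivative_of_real[OF assms], symmetric]
  by (simp add: inner_axis')

lemma C1_on_of_real:
  assumes f: "\<And>x. GDERIV f x :> g x" and g: "continuous_on UNIV g"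
  shows "C1_on D (\<lambda>x. complex_of_real (f x))"
proof -
  have "continuous_on D (\<lambda>x. complex_of_real (g x $ l))" for l
    by (intro continuous_intros continuous_on_subset[OF g]) auto
  then show ?thesis
    unfolding C1_on_def partial_deriv_of_real[OF f, abs_def]
    using GDERIV_imp_has_derivative_of_real[OF f] by (auto simp: differentiable_def)
qed

text \<open>The gradient is continuous on the whole plane, so the partial derivatives serve as their
  own extensions to the closure, whatever \<open>D\<close> is.\<close>

lemma C1_upto_boundary_of_real:
  assumes f: "\<And>x. GDERIV f x :> g x" and g: "continuous_on UNIV g"
  shows "C1_upto_boundary D (\<lambda>x. complex_of_real (f x))"
proof -
  have "continuous_on (closure D) (\<lambda>x. complex_of_real (f x))"
    by (rule has_derivative_continuous_on)
       (use GDERIV_imp_has_derivative_of_real[OF f] in \<open>blast intro: has_derivative_at_withinI\<close>)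
  moreover have "continuous_on (closure D) (\<lambda>x. complex_of_real (g x $ l))" for l
    by (intro continuous_intros continuous_on_subset[OF g]) auto
  ultimately show ?thesis
    unfolding C1_upto_boundary_def partial_deriv_of_real[OF f, abs_def]
    using C1_on_of_real[OF assms] by blast
qed

lemma C2_on_of_real:
  assumes f: "\<And>x. GDERIV f x :> g x"
    and g: "\<And>l x. GDERIV (\<lambda>y. g y $ l) x :> k l x" and k: "\<And>l. continuous_on UNIV (k l)"
  shows "C2_on D (\<lambda>x. complex_of_real (f x))"
proof -
  have "continuous_on UNIV (\<lambda>y. g y $ l)" for l
    by (rule has_derivative_continuous_on) (use g in \<open>auto simp: gderiv_def\<close>)
  then have "continuous_on UNIV (\<lambda>y. \<chi> l. g y $ l)"
    by (intro continuous_on_vec_lambda)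
  then have "continuous_on UNIV g" by simp
  then show ?thesis
    unfolding C2_on_def partial_deriv_of_real[OF f, abs_def]
    using C1_on_of_real[OF f] C1_on_of_real[OF g k] by blast
qed

lemma GDERIV_vec_nth: "GDERIV (\<lambda>y::real^'n. y $ m) x :> axis m 1"
  unfolding gderiv_def
  by (simp add: inner_axis bounded_linear_imp_has_derivative[OF bounded_linear_vec_nth])

lemma GDERIV_bessel_clifford_norm:
  "GDERIV (\<lambda>y. bessel_clifford p (a * (y \<bullet> y))) x
     :> (- 2 * a * bessel_clifford (Suc p) (a * (x \<bullet> x))) *\<^sub>R x"
proof -
  have "GDERIV (\<lambda>y. a * (y \<bullet> y)) x :> (2 * a) *\<^sub>R x"
    unfolding gderiv_def
    by (auto intro!: derivative_eq_intros simp: inner_commute)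
  from GDERIV_DERIV_compose[OF this DERIV_bessel_clifford] show ?thesis
    by (simp add: mult.commute mult.left_commute)
qed

subsection \<open>The torsional field\<close>

text \<open>The sign \<open>c\<close> and the index \<open>m\<close> let one calculation cover both
  components of the rotated position vector.\<close>

definition torsion_part :: "real \<Rightarrow> real \<Rightarrow> 2 \<Rightarrow> real^2 \<Rightarrow> real" where
  "torsion_part a c m x = c * (x $ m * bessel_clifford 1 (a * (x \<bullet> x)))"

definition torsion_field :: "real \<Rightarrow> real^2 \<Rightarrow> complex^2" where
  "torsion_field a x = (\<chi> k. complex_of_real
     (if k = 1 then torsion_part a (- 1) 2 x else torsion_part a 1 1 x))"

lemma torsion_field_nth:
  "torsion_field a x $ 1 = complex_of_real (torsion_part a (- 1) 2 x)"
  "torsion_field a x $ 2 = complex_of_real (torsion_part a 1 1 x)"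
  by (simp_all add: torsion_field_def)

definition torsion_grad :: "real \<Rightarrow> real \<Rightarrow> 2 \<Rightarrow> real^2 \<Rightarrow> real^2" where
  "torsion_grad a c m x = c *\<^sub>R (bessel_clifford 1 (a * (x \<bullet> x)) *\<^sub>R axis m 1
     + (x $ m * (- 2 * a * bessel_clifford 2 (a * (x \<bullet> x)))) *\<^sub>R x)"

lemma GDERIV_torsion_part: "GDERIV (torsion_part a c m) x :> torsion_grad a c m x"
proof -
  have "GDERIV (\<lambda>y. c * (y $ m * bessel_clifford 1 (a * (y \<bullet> y)))) x :>
      c *\<^sub>R ((x $ m) *\<^sub>R ((- 2 * a * bessel_clifford (Suc 1) (a * (x \<bullet> x))) *\<^sub>R x)
        + bessel_clifford 1 (a * (x \<bullet> x)) *\<^sub>R axis m 1)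
      + (x $ m * bessel_clifford 1 (a * (x \<bullet> x))) *\<^sub>R 0"
    by (intro GDERIV_mult GDERIV_const GDERIV_vec_nth GDERIV_bessel_clifford_norm)
  then show ?thesis
    by (simp add: torsion_part_def[abs_def] torsion_grad_def numeral_2_eq_2 add.commute)
qed

lemma continuous_on_torsion_grad: "continuous_on S (torsion_grad a c m)"
  unfolding torsion_grad_def[abs_def] by (intro continuous_intros)

definition torsion_hess :: "real \<Rightarrow> real \<Rightarrow> 2 \<Rightarrow> 2 \<Rightarrow> real^2 \<Rightarrow> real^2" where
  "torsion_hess a c m l x = c *\<^sub>R
     ((axis m 1 $ l * (- 2 * a * bessel_clifford 2 (a * (x \<bullet> x)))) *\<^sub>R x
      + (- 2 * a) *\<^sub>R ((x $ m * x $ l) *\<^sub>R ((- 2 * a * bessel_clifford 3 (a * (x \<bullet> x))) *\<^sub>R x)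
         + bessel_clifford 2 (a * (x \<bullet> x)) *\<^sub>R (x $ m *\<^sub>R axis l 1 + x $ l *\<^sub>R axis m 1)))"

lemma GDERIV_torsion_grad: "GDERIV (\<lambda>y. torsion_grad a c m y $ l) x :> torsion_hess a c m l x"
proof -
  let ?b = "\<lambda>p y. bessel_clifford p (a * (y \<bullet> y))"
  \<comment> \<open>The gradient is kept in the raw shape of the product rule; the zero terms come
    from constant factors.\<close>
  have "GDERIV (\<lambda>y. c * (axis m 1 $ l * ?b 1 y + (- 2 * a) * ((y $ m * y $ l) * ?b 2 y))) x :>
      c *\<^sub>R ((axis m 1 $ l *\<^sub>R ((- 2 * a * ?b (Suc 1) x) *\<^sub>R x) + ?b 1 x *\<^sub>R 0)
        + ((- 2 * a) *\<^sub>R ((x $ m * x $ l) *\<^sub>R ((- 2 * a * ?b (Suc 2) x) *\<^sub>R x)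
            + ?b 2 x *\<^sub>R (x $ m *\<^sub>R axis l 1 + x $ l *\<^sub>R axis m 1))
          + ((x $ m * x $ l) * ?b 2 x) *\<^sub>R 0))
      + (axis m 1 $ l * ?b 1 x + (- 2 * a) * ((x $ m * x $ l) * ?b 2 x)) *\<^sub>R 0"
    by (intro GDERIV_mult GDERIV_add GDERIV_const GDERIV_vec_nth GDERIV_bessel_clifford_norm)
  moreover have "(\<lambda>y. torsion_grad a c m y $ l)
      = (\<lambda>y. c * (axis m 1 $ l * ?b 1 y + (- 2 * a) * ((y $ m * y $ l) * ?b 2 y)))"
    by (simp add: torsion_grad_def fun_eq_iff algebra_simps)
  moreover have "Suc 1 = 2" "Suc 2 = 3" by simp_all
  ultimately show ?thesis
    by (simp only: torsion_hess_def scaleR_zero_right add_0_right scaleR_scaleR)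
qed

lemma continuous_on_torsion_hess: "continuous_on S (torsion_hess a c m l)"
  unfolding torsion_hess_def[abs_def] by (intro continuous_intros)

lemma classically_regular_torsion_field: "classically_regular D (torsion_field a)"
proof -
  have "C2_on D (\<lambda>x. complex_of_real (torsion_part a c m x))" for c m
    by (rule C2_on_of_real[OF GDERIV_torsion_part GDERIV_torsion_grad continuous_on_torsion_hess])
  moreover have "C1_upto_boundary D (\<lambda>x. complex_of_real (torsion_part a c m x))" for c m
    by (rule C1_upto_boundary_of_real[OF GDERIV_torsion_part continuous_on_torsion_grad])
  ultimately show ?thesis
    unfolding classically_regular_def forall_2 torsion_field_nth by blast
qed

section \<open>Stress and equation of motion of the torsional field\<close>

lemma inner_real_2: "(x::real^2) \<bullet> x = x $ 1 * x $ 1 + x $ 2 * x $ 2"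
  by (simp add: inner_vec_def sum_2)

text \<open>Away from the origin the quadratic factor is -|x|^2 (\<nu>_i \<tau>_j + \<tau>_i
  \<nu>_j), a pure shear between the normal and tangential directions.\<close>

definition torsion_stress :: "real \<Rightarrow> real \<Rightarrow> 2 \<Rightarrow> 2 \<Rightarrow> real^2 \<Rightarrow> real" where
  "torsion_stress mu a i j x = 2 * a * mu * ((if i = j then
       (if i = 1 then 2 else - 2) * (x $ 1 * x $ 2) else x $ 2 * x $ 2 - x $ 1 * x $ 1)
     * bessel_clifford 2 (a * (x \<bullet> x)))"

lemma axis_2_nth:
  "(axis 1 1 :: real^2) $ 1 = 1" "(axis 1 1 :: real^2) $ 2 = 0"
  "(axis 2 1 :: real^2) $ 1 = 0" "(axis 2 1 :: real^2) $ 2 = 1"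
  by (simp_all add: axis_def)

lemma two_cases: fixes i :: 2 obtains "i = 1" | "i = 2"
  using exhaust_2 by blast

text \<open>Zero divergence removes \<open>lam\<close>. The undifferentiated profile enters the
  gradient only as an infinitesimal rotation, which symmetrisation cancels.\<close>

lemma stress_torsion_field:
  "stress lam mu (torsion_field a) x $ i $ j = complex_of_real (torsion_stress mu a i j x)"
  by (cases i rule: two_cases; cases j rule: two_cases)
     (simp_all add: stress_def sum_2 torsion_field_nth
      partial_deriv_of_real[OF GDERIV_torsion_part, abs_def]
      elastic_tensor_def kronecker_def torsion_stress_def torsion_grad_def axis_2_nth
      algebra_simps)

lemma GDERIV_torsion_stress:
  fixes x :: "real^2" and a :: real
  defines "b \<equiv> \<lambda>p. bessel_clifford p (a * (x \<bullet> x))"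
  shows "GDERIV (torsion_stress mu a i j) x :> (2 * a * mu) *\<^sub>R
    ((if i = j then (if i = 1 then 2 else - 2) * (x $ 1 * x $ 2) else x $ 2 * x $ 2 - x $ 1 * x $ 1)
       *\<^sub>R ((- 2 * a * b 3) *\<^sub>R x)
     + b 2 *\<^sub>R (if i = j then (if i = 1 then 2 else - 2) *\<^sub>R (x $ 1 *\<^sub>R axis 2 1 + x $ 2 *\<^sub>R axis 1 1)
         else 2 *\<^sub>R (x $ 2 *\<^sub>R axis 2 1 - x $ 1 *\<^sub>R axis 1 1)))"
proof -
  have prod: "GDERIV (\<lambda>y. y $ k * y $ l) x :> x $ k *\<^sub>R axis l 1 + x $ l *\<^sub>R axis k 1" for k l :: 2
    by (intro GDERIV_mult GDERIV_vec_nth)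
  have square: "GDERIV (\<lambda>y. y $ k * y $ k) x :> 2 *\<^sub>R (x $ k *\<^sub>R axis k 1)" for k :: 2
    unfolding scaleR_2 by (rule prod)
  have q: "GDERIV (\<lambda>y. if i = j then (if i = 1 then 2 else - 2) * (y $ 1 * y $ 2)
          else y $ 2 * y $ 2 - y $ 1 * y $ 1) x :>
      (if i = j then (if i = 1 then 2 else - 2) *\<^sub>R (x $ 1 *\<^sub>R axis 2 1 + x $ 2 *\<^sub>R axis 1 1)
         else 2 *\<^sub>R (x $ 2 *\<^sub>R axis 2 1 - x $ 1 *\<^sub>R axis 1 1))"
  proof (cases "i = j")
    case True
    then show ?thesis
      using GDERIV_mult[OF GDERIV_const[of "if i = 1 then 2 else - 2"] prod[of 1 2]] by simp
  next
    case False
    then show ?thesis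
      using GDERIV_diff[OF square[of 2] square[of 1]] by (simp add: scaleR_diff_right)
  qed
  have "Suc 2 = 3" by simp
  then show ?thesis
    using GDERIV_mult[OF GDERIV_const[of "2 * a * mu"] GDERIV_mult[OF q GDERIV_bessel_clifford_norm[of 2 a]]]
    unfolding torsion_stress_def[abs_def] b_def
    by (simp only: scaleR_zero_right add_0_right)
qed

text \<open>Write B_p for \<open>bessel_clifford p\<close> at s = a |x|^2. The quadratic terms of
  the divergence combine to |x|^2, giving 4 a mu (2 B_2 - s B_3) times (x_2, -x_1); the recurrence
  turns the bracket into B_1.\<close>

lemma div_stress_torsion_field:
  "div_stress lam mu (torsion_field a) x + (4 * a * mu) *\<^sub>R torsion_field a x = 0"
proof -
  \<comment> \<open>The index is \<open>Suc 0\<close> because simplification rewrites 1 so; |x|^2 is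
    expanded only as a factor, not inside the arguments.\<close>
  have rec: "bessel_clifford (Suc 0) (a * (x \<bullet> x)) = 2 * bessel_clifford 2 (a * (x \<bullet> x))
      - a * (x $ 1 * x $ 1 + x $ 2 * x $ 2) * bessel_clifford 3 (a * (x \<bullet> x))"
    using bessel_clifford_recurrence[of 1 "a * (x \<bullet> x)"]
    by (simp add: numeral_2_eq_2 numeral_3_eq_3 inner_real_2)
  have "(div_stress lam mu (torsion_field a) x + (4 * a * mu) *\<^sub>R torsion_field a x) $ i = 0" for i
    by (cases i rule: two_cases)
       (simp_all add: div_stress_def stress_torsion_field partial_deriv_of_real[OF GDERIV_torsion_stress]
        sum_2 axis_2_nth torsion_field_nth torsion_part_def rec scaleR_conv_of_real[where 'a = complex]
        algebra_simps)
  then show ?thesis by (simp add: vec_eq_iff)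
qed

text \<open>The stress is continuous everywhere and the normal away from the origin, so the limit is
  the value at \<open>z\<close>, from whichever side \<open>D\<close> approaches.\<close>

lemma has_boundary_traction_torsion_field:
  assumes "z \<noteq> 0"
  shows "has_boundary_traction lam mu D (torsion_field a) z (traction lam mu (torsion_field a) z)"
proof -
  have "isCont (torsion_stress mu a i j) z" for i j
    using GDERIV_torsion_stress unfolding gderiv_def by (rule has_derivative_continuous)
  moreover have "isCont (\<lambda>x. radial_normal x $ j) z" for j
    unfolding radial_normal_def using assms by (intro continuous_intros) auto
  ultimately have "isCont (\<lambda>x. traction lam mu (torsion_field a) x $ i) z" for i
    unfolding traction_def stress_torsion_field by (auto intro!: continuous_intros)
  then have "(traction lam mu (torsion_field a) \<longlongrightarrow> traction lam mu (torsion_field a) z) (at z)"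
    unfolding isCont_def by (intro vec_tendstoI) auto
  then show ?thesis
    unfolding has_boundary_traction_def by (rule tendsto_within_subset) auto
qed

lemma traction_torsion_field_eq_0:
  assumes "bessel_clifford 2 (a * (z \<bullet> z)) = 0"
  shows "traction lam mu (torsion_field a) z = 0"
  using assms by (simp add: traction_def stress_torsion_field torsion_stress_def vec_eq_iff)

text \<open>The field vanishes at the origin, but at (t, 0) its second component is t times the
  profile at a t^2, which tends to 1 as t tends to 0.\<close>

lemma torsion_field_nonzero:
  assumes "r > 0"
  shows "\<exists>x\<in>disk r. torsion_field a x \<noteq> 0"
proof -
  have "isCont (\<lambda>t. bessel_clifford 1 (a * t\<^sup>2)) 0"
    by (rule continuous_on_interior[of UNIV]) (auto intro!: continuous_intros)
  then have "((\<lambda>t. bessel_clifford 1 (a * t\<^sup>2)) \<longlongrightarrow> 1) (at_right 0)"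
    by (auto simp: isCont_def bessel_clifford_0 intro: tendsto_within_subset)
  then have "eventually (\<lambda>t. bessel_clifford 1 (a * t\<^sup>2) > 0) (at_right 0)"
    by (rule order_tendstoD) simp
  from eventually_conj[OF this eventually_at_right_real[OF assms]]
  have "\<exists>t. bessel_clifford 1 (a * t\<^sup>2) > 0 \<and> t \<in> {0<..<r}"
    by (rule eventually_happens'[OF trivial_limit_at_right_real])
  then obtain t where t: "bessel_clifford 1 (a * t\<^sup>2) > 0" "0 < t" "t < r" by auto
  have "torsion_field a (axis 1 t) $ 2 \<noteq> 0"
    using t by (simp add: torsion_field_nth torsion_part_def inner_axis_axis power2_eq_square)
  moreover have "axis 1 t \<in> disk r"
    using t by (simp add: disk_def norm_eq_sqrt_inner inner_axis_axis)
  ultimately show ?thesis by force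
qed

theorem mainTheorem4:
  fixes omega lam mu r0 r1 :: real
  assumes "omega > 0" and "mu > 0" and "lam + mu > 0"
    and "0 < r0" and "r0 < r1"
  shows "\<exists>rho0 rho1 :: real. rho0 > 0 \<and> rho1 > 0 \<and>
    (\<exists>u0 u1 :: real^2 \<Rightarrow> complex^2.
       transmission_solution lam mu omega r0 r1 rho0 rho1 u0 u1 \<and>
       ((\<exists>x\<in>disk r0. u0 x \<noteq> 0) \<or> (\<exists>x\<in>annulus r0 r1. u1 x \<noteq> 0)))"
proof -
  obtain s where s: "s > 0" "bessel_clifford 2 s = 0" by (rule bessel_clifford_2_zero)
  \<comment> \<open>This scaling places the zero \<open>s\<close> on the outer circle.\<close>
  define a where "a = s / r1\<^sup>2"
  define rho where "rho = 4 * a * mu / omega\<^sup>2"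
  have a: "a > 0" using s assms by (simp add: a_def)
  then have rho: "rho > 0" "omega\<^sup>2 * rho = 4 * a * mu"
    using assms by (simp_all add: rho_def)
  have outer: "has_boundary_traction lam mu D (torsion_field a) z 0" if "norm z = r1" for z D
  proof -
    have "a * (z \<bullet> z) = s"
      using that assms by (simp add: a_def power2_norm_eq_inner[symmetric])
    then have "traction lam mu (torsion_field a) z = 0"
      using s by (intro traction_torsion_field_eq_0) simp
    moreover have "z \<noteq> 0" using that assms by auto
    ultimately show ?thesis using has_boundary_traction_torsion_field by metis
  qed
  \<comment> \<open>One smooth field is used on both sides, so both one-sided tractions share a
    limit.\<close>
  have inner: "\<exists>t. has_boundary_traction lam mu D (torsion_field a) z t \<and>
      has_boundary_traction lam mu D' (torsion_field a) z t" if "norm z = r0" for z D D'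
  proof -
    have "z \<noteq> 0" using that assms by auto
    then show ?thesis using has_boundary_traction_torsion_field by blast
  qed
  have "transmission_solution lam mu omega r0 r1 rho rho (torsion_field a) (torsion_field a)"
    unfolding transmission_solution_def rho(2)
    using outer inner by (simp add: classically_regular_torsion_field div_stress_torsion_field)
  then show ?thesis
    using rho(1) torsion_field_nonzero[OF assms(4), of a] by blast
qed

end
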